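(* For every integer $n\ge 3$, $$\mathrm{ex}(n,\overrightarrow{K_{2,2}})=\mathrm{ex}(n,n;C_4).$$ Furthermore, $\mathrm{EX}(n,\overrightarrow{K_{2,2}})=\{D:\ \mathrm{Brp}(D)\in \mathrm{EX}(n,n;C_4)\}$, where $D$ ranges over digraphs on $n$ vertices.
   Context: Graphs are finite and simple. Digraphs are finite and strict: no loops and no parallel arcs in the same direction, but both arcs $uv$ and $vu$ may be present. $C_4$ is the (undirected) cycle on $4$ vertices. $\overrightarrow{K_{2,2}}$ is the orientation of $C_4$ with four distinct vertices $a_1,a_2,b_1,b_2$ and arcs $a_1b_1$, $a_1b_2$, $a_2b_1$, $a_2b_2$. A graph (digraph) is $H$-free if it contains no (not necessarily induced) subgraph (subdigraph) isomorphic to the graph (digraph) $H$. For a digraph $H$, $\mathrm{ex}(n,H)$ is the maximum number of arcs of an $H$-free digraph on $n$ vertices, and $\mathrm{EX}(n,H)$ is the family of all $H$-free digraphs on $n$ vertices with exactly $\mathrm{ex}(n,H)$ arcs. For a bipartite graph $H$, $\mathrm{ex}(n,n;H)$ is the maximum number of edges of an $H$-free bipartite graph with partition sets of equal size $n$, and $\mathrm{EX}(n,n;H)$ is the set of all $H$-free bipartite graphs with partition sets of equal size $n$ and exactly $\mathrm{ex}(n,n;H)$ edges. Families are considered up to isomorphism. For a digraph $D$ with vertex set $\{v_1,\dots,v_n\}$, the bipartite representation $\mathrm{Brp}(D)$ is the bipartite graph with partition sets $X=\{x_1,\dots,x_n\}$ and $Y=\{y_1,\dots,y_n\}$ in which $x_iy_j$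 is an edge if and only if $v_iv_j$ is an arc of $D$. *)

theory Defs
  imports "Graph_Theory.Pair_Digraph" "Graph_Theory.Digraph_Isomorphism"
begin

text \<open>
  Digraphs (finite, no loops, no parallel arcs, opposite arcs allowed) are values of type
  \<open>'a pair_pre_digraph\<close> satisfying \<open>pair_digraph\<close>. As usual in this library, a finite simple
  graph is a symmetric such digraph (\<open>pair_graph\<close>): an edge is a pair of opposite arcs.
\<close>

definition undirected_edges :: "'a pair_pre_digraph \<Rightarrow> 'a set set" where
  "undirected_edges G = (\<lambda>(u, v). {u, v}) ` parcs G"

text \<open>
  This serves both digraphs and graphs: for symmetric digraphs, isomorphism as digraphs is
  isomorphism of the underlying graphs, and a subdigraph isomorphic to a symmetric digraph
  is itself symmetric.
\<close>

definition contains_copy :: "'a pair_pre_digraph \<Rightarrow> 'h pair_pre_digraph \<Rightarrow> bool" where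
  "contains_copy G H \<longleftrightarrow>
     (\<exists>S. subgraph S (with_proj G) \<and> digraph_iso (with_proj H) S)"

definition H_free :: "'h pair_pre_digraph \<Rightarrow> 'a pair_pre_digraph \<Rightarrow> bool" where
  "H_free H G \<longleftrightarrow> \<not> contains_copy G H"

definition C4 :: "nat pair_pre_digraph" where
  "C4 = \<lparr> pverts = {0, 1, 2, 3},
          parcs = {(0, 1), (1, 2), (2, 3), (3, 0), (1, 0), (2, 1), (3, 2), (0, 3)} \<rparr>"

text \<open>Here \<open>a\<^sub>1, a\<^sub>2, b\<^sub>1, b\<^sub>2\<close> are the numbers 0, 1, 2, 3.\<close>

definition K22 :: "nat pair_pre_digraph" where
  "K22 = \<lparr> pverts = {0, 1, 2, 3}, parcs = {(0, 2), (0, 3), (1, 2), (1, 3)} \<rparr>"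

text \<open>
  The maxima range over vertices of type \<open>nat\<close>, which represents every finite (di)graph up to
  isomorphism. The extremal families are the isomorphism-closed sets of all extremal (di)graphs
  over an arbitrary vertex type.
\<close>

definition digraphs_free :: "nat \<Rightarrow> 'h pair_pre_digraph \<Rightarrow> 'a pair_pre_digraph set" where
  "digraphs_free n H = {D. pair_digraph D \<and> card (pverts D) = n \<and> H_free H D}"

definition ex_di :: "nat \<Rightarrow> 'h pair_pre_digraph \<Rightarrow> nat" where
  "ex_di n H = Max ((\<lambda>D :: nat pair_pre_digraph. card (parcs D)) ` digraphs_free n H)"

definition EX_di :: "nat \<Rightarrow> 'h pair_pre_digraph \<Rightarrow> 'a pair_pre_digraph set" where
  "EX_di n H = {D \<in> digraphs_free n H. card (parcs D) = ex_di n H}"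

definition balanced_bipartite :: "nat \<Rightarrow> 'a pair_pre_digraph \<Rightarrow> bool" where
  "balanced_bipartite n G \<longleftrightarrow> pair_graph G \<and>
     (\<exists>X Y. pverts G = X \<union> Y \<and> X \<inter> Y = {} \<and> card X = n \<and> card Y = n \<and>
            parcs G \<subseteq> X \<times> Y \<union> Y \<times> X)"

definition bipartite_free :: "nat \<Rightarrow> 'h pair_pre_digraph \<Rightarrow> 'a pair_pre_digraph set" where
  "bipartite_free n H = {G. balanced_bipartite n G \<and> H_free H G}"

definition ex_bip :: "nat \<Rightarrow> 'h pair_pre_digraph \<Rightarrow> nat" where
  "ex_bip n H =
     Max ((\<lambda>G :: nat pair_pre_digraph. card (undirected_edges G)) ` bipartite_free n H)"

definition EX_bip :: "nat \<Rightarrow> 'h pair_pre_digraph \<Rightarrow> 'a pair_pre_digraph set" where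
  "EX_bip n H = {G \<in> bipartite_free n H. card (undirected_edges G) = ex_bip n H}"

text \<open>For a vertex \<open>v\<close> of \<open>D\<close>, its copies in the two partition sets are \<open>Inl v\<close> and \<open>Inr v\<close>.\<close>

definition Brp :: "'a pair_pre_digraph \<Rightarrow> ('a + 'a) pair_pre_digraph" where
  "Brp D = \<lparr> pverts = pverts D <+> pverts D,
             parcs = (\<Union>(u, v) \<in> parcs D. {(Inl u, Inr v), (Inr v, Inl u)}) \<rparr>"

end

theory Submission
  imports Defs
begin

text \<open>
  Read arcs of a digraph, or edges of a bipartite graph from \<open>X\<close> to \<open>Y\<close>, as a 0/1 matrix: both
  forbidden configurations become a rectangle of ones. A loopless digraph is the same as such a
  matrix together with an identification of rows and columns whose diagonal vanishes. If no row
  and no column is full, this identification exists: take one with the fewest ones on the diagonal;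
  a remaining one could be removed by exchanging two columns or, if that fails, by rotating
  three, because rectangle-freeness forces the critical new diagonal entry to be zero. If some
  row or column is full, there are fewer than \<open>2 n\<close> ones, and the digraph on
  \<open>\<int>/n\<close> with arcs \<open>i \<rightarrow> i + 1\<close> and \<open>i \<rightarrow> i + 2\<close> does better.
\<close>

section \<open>Rectangle-free relations\<close>

text \<open>The matrix has no 2 by 2 submatrix of ones. Rows and columns need not come from the same
  set, so digraphs and bipartite graphs are covered alike.\<close>

definition rect_free :: "('a \<times> 'b) set \<Rightarrow> bool" where
  "rect_free E \<longleftrightarrow> (\<forall>x x' y y'. (x, y) \<in> E \<longrightarrow> (x, y') \<in> E \<longrightarrow> (x', y) \<in> E \<longrightarrow> (x', y') \<in> E
     \<longrightarrow> x = x' \<or> y = y')"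

lemma rect_freeD:
  "rect_free E \<Longrightarrow> (x, y) \<in> E \<Longrightarrow> (x, y') \<in> E \<Longrightarrow> (x', y) \<in> E \<Longrightarrow> (x', y') \<in> E \<Longrightarrow> x \<noteq> x' \<Longrightarrow> y = y'"
  unfolding rect_free_def by blast

lemma rect_free_converse: "rect_free E \<Longrightarrow> rect_free (E\<inverse>)"
  unfolding rect_free_def by blast

text \<open>Rows and columns can be renamed independently: this passes between one vertex set used
  twice and two disjoint sides.\<close>

lemma rect_free_map_prod:
  assumes "inj_on f X" "inj_on g Y" "E \<subseteq> X \<times> Y"
  shows "rect_free (map_prod f g ` E) \<longleftrightarrow> rect_free E"
proof
  have mem: "(f x, g y) \<in> map_prod f g ` E \<longleftrightarrow> (x, y) \<in> E" if "x \<in> X" "y \<in> Y" for x y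
    using that assms by (force dest: inj_onD)
  show "rect_free E" if R: "rect_free (map_prod f g ` E)"
    unfolding rect_free_def
  proof (intro allI impI)
    fix x x' y y'
    assume E: "(x, y) \<in> E" "(x, y') \<in> E" "(x', y) \<in> E" "(x', y') \<in> E"
    then have XY: "x \<in> X" "x' \<in> X" "y \<in> Y" "y' \<in> Y" using assms(3) by auto
    have "f x = f x' \<or> g y = g y'"
      using rect_freeD[OF R, of "f x" "g y" "g y'" "f x'"] E XY mem by blast
    then show "x = x' \<or> y = y'" using XY assms(1,2) by (auto dest: inj_onD)
  qed
  show "rect_free (map_prod f g ` E)" if R: "rect_free E"
    unfolding rect_free_def
  proof (intro allI impI)
    fix a a' b b'
    assume E: "(a, b) \<in> map_prod f g ` E" "(a, b') \<in> map_prod f g ` E"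
      "(a', b) \<in> map_prod f g ` E" "(a', b') \<in> map_prod f g ` E"
    from E(1) obtain x y where "a = f x" "b = g y" "x \<in> X" "y \<in> Y"
      using assms(3) by auto
    moreover from E(4) obtain x' y' where "a' = f x'" "b' = g y'" "x' \<in> X" "y' \<in> Y"
      using assms(3) by auto
    ultimately show "a = a' \<or> b = b'"
      using E mem rect_freeD[OF R, of x y y' x'] by auto
  qed
qed

lemma card_map_prod_image:
  assumes "inj_on f X" "inj_on g Y" "E \<subseteq> X \<times> Y"
  shows "card (map_prod f g ` E) = card E"
  using assms by (intro card_image inj_on_subset[OF map_prod_inj_on])

text \<open>Two ones in another row would span a rectangle with the full row, so every other row has
  at most one: \<open>card Y\<close> ones in row \<open>x\<close> and at most
  \<open>card X - 1\<close> elsewhere.\<close>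

lemma card_full_row:
  assumes R: "rect_free E" and E: "E \<subseteq> X \<times> Y" and fin: "finite X" "finite Y"
    and x: "x \<in> X" and full: "{x} \<times> Y \<subseteq> E"
  shows "card E < card X + card Y"
proof -
  define F where "F = {e \<in> E. fst e \<noteq> x}"
  have "inj_on fst F"
    using full E rect_freeD[OF R, of x] by (fastforce simp: F_def inj_on_def)
  moreover have "fst ` F \<subseteq> X - {x}" using E by (auto simp: F_def)
  ultimately have "card F \<le> card (X - {x})"
    using fin(1) by (metis card_inj_on_le finite_Diff)
  moreover have "card (X - {x}) < card X" using fin(1) x by (rule card_Diff1_less)
  moreover have "E = {x} \<times> Y \<union> F" using full E by (auto simp: F_def)
  then have "card E \<le> card ({x} \<times> Y) + card F" by (metis card_Un_le)
  ultimately show ?thesis by (simp add: card_cartesian_product)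
qed

lemma card_full_column:
  assumes "rect_free E" "E \<subseteq> X \<times> Y" "finite X" "finite Y" "y \<in> Y" "X \<times> {y} \<subseteq> E"
  shows "card E < card X + card Y"
proof -
  have "card (E\<inverse>) < card Y + card X"
    using assms by (intro card_full_row[where x = y] rect_free_converse) auto
  then show ?thesis by simp
qed

section \<open>Bijections avoiding a rectangle-free relation\<close>

lemma rect_free_avoiding_bijection:
  assumes R: "rect_free E" and fin: "finite X" "finite Y" and card: "card X = card Y"
    and row: "\<And>x. x \<in> X \<Longrightarrow> \<not> {x} \<times> Y \<subseteq> E"
    and col: "\<And>y. y \<in> Y \<Longrightarrow> \<not> X \<times> {y} \<subseteq> E"
  obtains f where "bij_betw f X Y" "\<And>x. x \<in> X \<Longrightarrow> (x, f x) \<notin> E"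
proof -
  define bad where "bad f = {x \<in> X. (x, f x) \<in> E}" for f
  obtain f0 where "bij_betw f0 X Y" using finite_same_card_bij[OF fin card] ..
  then obtain f where f: "bij_betw f X Y"
    and least: "\<And>g. bij_betw g X Y \<Longrightarrow> card (bad f) \<le> card (bad g)"
    using ex_has_least_nat[of "\<lambda>f. bij_betw f X Y" f0 "\<lambda>f. card (bad f)"] by blast
  \<comment> \<open>An injective self-map \<open>h\<close> of the finite set \<open>X\<close> is a
    permutation, so \<open>f \<circ> h\<close> competes with \<open>f\<close>; minimality forbids
    losing a bad row without gaining one.\<close>
  have no_improvement: "z \<notin> bad f"
    if h: "h ` X \<subseteq> X" "inj_on h X" and sub: "bad (f \<circ> h) \<subseteq> bad f - {z}" for h z
  proof
    assume "z \<in> bad f"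
    have "finite (bad f)" using fin by (simp add: bad_def)
    then have "card (bad (f \<circ> h)) < card (bad f)"
      using sub \<open>z \<in> bad f\<close> by (intro psubset_card_mono) auto
    moreover have "bij_betw h X X"
      using h fin(1) by (simp add: bij_betw_def endo_inj_surj)
    then have "bij_betw (f \<circ> h) X Y" using f by (rule bij_betw_trans)
    ultimately show False using least by (metis leD)
  qed
  have "(x, f x) \<notin> E" if x: "x \<in> X" for x
  proof
    assume one: "(x, f x) \<in> E"
    have surj: "f ` X = Y" using f by (simp add: bij_betw_def)
    \<comment> \<open>Exchanging the columns of \<open>x\<close> and \<open>j\<close> puts
      \<open>(x, f j)\<close> and \<open>(j, f x)\<close> on the diagonal; were both zeros,
      \<open>x\<close> would be repaired at no cost.\<close>
    have swap: "(j, f x) \<in> E" if j: "j \<in> X" "(x, f j) \<notin> E" for j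
    proof (rule ccontr)
      assume "(j, f x) \<notin> E"
      then have "bad (f \<circ> id(x := j, j := x)) \<subseteq> bad f - {x}"
        using j by (auto simp: bad_def split: if_splits)
      then have "x \<notin> bad f"
        using x j by (intro no_improvement) (auto simp: inj_on_def)
      then show False using x one by (simp add: bad_def)
    qed
    obtain j where j: "j \<in> X" "(x, f j) \<notin> E" using row[OF x] surj by auto
    obtain k where k: "k \<in> X" "(k, f x) \<notin> E" using col[of "f x"] x surj by auto
    \<comment> \<open>The second claim is the contrapositive of \<open>swap\<close> for
      \<open>k\<close>.\<close>
    have jx: "(j, f x) \<in> E" and xk: "(x, f k) \<in> E" using swap j k by blast+
    have ne: "j \<noteq> x" "k \<noteq> x" "j \<noteq> k" using one j k jx by auto
    have "f k \<noteq> f x" using f k x ne by (auto simp: bij_betw_def dest: inj_onD)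
    \<comment> \<open>A one here would complete a rectangle in rows \<open>x\<close>,
      \<open>j\<close> and columns \<open>f x\<close>, \<open>f k\<close>.\<close>
    then have "(j, f k) \<notin> E"
      using rect_freeD[OF R one xk jx] ne by auto
    \<comment> \<open>The rotation's new diagonal entries \<open>(x, f j)\<close>,
      \<open>(j, f k)\<close>, \<open>(k, f x)\<close> are all zeros.\<close>
    then have "bad (f \<circ> id(x := j, j := k, k := x)) \<subseteq> bad f - {x}"
      using j k ne by (auto simp: bad_def split: if_splits)
    then have "x \<notin> bad f"
      using x j k ne by (intro no_improvement) (auto simp: inj_on_def)
    then show False using x one by (simp add: bad_def)
  qed
  then show thesis using that f by blast
qed

section \<open>Forbidden subgraphs as rectangles\<close>

text \<open>A library isomorphism carries separate maps for arcs, tails and heads. Being a subgraph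
  of \<open>with_proj G\<close> forces the projections as tail and head, so the vertex map
  determines the arc map.\<close>

lemma contains_copy_iff:
  assumes "pair_wf_digraph G" "pair_wf_digraph H"
  shows "contains_copy G H \<longleftrightarrow>
    (\<exists>f. inj_on f (pverts H) \<and> f ` pverts H \<subseteq> pverts G \<and> map_prod f f ` parcs H \<subseteq> parcs G)"
proof
  assume "contains_copy G H"
  then obtain h where sub: "subgraph (app_iso h (with_proj H)) (with_proj G)"
    and iso: "pre_digraph.digraph_isomorphism (with_proj H) h"
    unfolding contains_copy_def digraph_iso_def by blast
  have ends: "iso_tail h = fst" "iso_head h = snd"
    using sub by (auto simp: subgraph_def compatible_def)
  have "(iso_verts h u, iso_verts h v) = iso_arcs h (u, v)" if "(u, v) \<in> parcs H" for u v
    using iso that ends unfolding pre_digraph.digraph_isomorphism_def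
    by (auto intro!: prod_eqI dest!: bspec)
  then have "map_prod (iso_verts h) (iso_verts h) ` parcs H \<subseteq> parcs G"
    using sub by (auto simp: subgraph_def)
  moreover have "inj_on (iso_verts h) (pverts H)" "iso_verts h ` pverts H \<subseteq> pverts G"
    using iso sub by (auto simp: pre_digraph.digraph_isomorphism_def subgraph_def)
  ultimately show "\<exists>f. inj_on f (pverts H) \<and> f ` pverts H \<subseteq> pverts G \<and>
      map_prod f f ` parcs H \<subseteq> parcs G" by blast
next
  assume "\<exists>f. inj_on f (pverts H) \<and> f ` pverts H \<subseteq> pverts G \<and> map_prod f f ` parcs H \<subseteq> parcs G"
  then obtain f where f: "inj_on f (pverts H)" "f ` pverts H \<subseteq> pverts G"
    "map_prod f f ` parcs H \<subseteq> parcs G" by blast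
  let ?h = "\<lparr>iso_verts = f, iso_arcs = map_prod f f, iso_head = snd, iso_tail = fst\<rparr>"
  interpret G: pair_wf_digraph G by fact
  interpret H: pair_wf_digraph H by fact
  have "parcs H \<subseteq> pverts H \<times> pverts H"
    using H.arc_fst_in_verts H.arc_snd_in_verts by force
  then have "inj_on (map_prod f f) (parcs H)"
    using f(1) by (intro inj_on_subset[OF map_prod_inj_on])
  then have iso: "H.digraph_isomorphism ?h"
    using f(1) H.wf_digraph_axioms by (auto simp: H.digraph_isomorphism_def)
  then have "subgraph (app_iso ?h (with_proj H)) (with_proj G)"
    using f G.wf_digraph_axioms H.wf_digraphI_app_iso[OF iso]
    by (auto simp: subgraph_def compatible_def)
  then show "contains_copy G H"
    using iso unfolding contains_copy_def digraph_iso_def by blast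
qed

lemma H_free_K22_iff:
  assumes "pair_digraph D"
  shows "H_free K22 D \<longleftrightarrow> rect_free (parcs D)"
proof -
  interpret pair_digraph D by fact
  have wf: "pair_wf_digraph D" "pair_wf_digraph K22"
    by (unfold_locales) (auto simp: K22_def)
  have "contains_copy D K22 \<longleftrightarrow> \<not> rect_free (parcs D)"
  proof
    assume "contains_copy D K22"
    then obtain f where "inj_on f (pverts K22)" and arcs: "map_prod f f ` parcs K22 \<subseteq> parcs D"
      unfolding contains_copy_iff[OF wf] by blast
    then have "f 0 \<noteq> f 1" "f 2 \<noteq> f 3" by (simp_all add: K22_def inj_on_def)
    moreover have "(f 0, f 2) \<in> parcs D" "(f 0, f 3) \<in> parcs D" "(f 1, f 2) \<in> parcs D"
        "(f 1, f 3) \<in> parcs D"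
      using arcs by (simp_all add: K22_def)
    ultimately show "\<not> rect_free (parcs D)" unfolding rect_free_def by blast
  next
    assume "\<not> rect_free (parcs D)"
    then obtain x x' y y' where a: "(x, y) \<in> parcs D" "(x, y') \<in> parcs D" "(x', y) \<in> parcs D"
      "(x', y') \<in> parcs D" and ne: "x \<noteq> x'" "y \<noteq> y'"
      unfolding rect_free_def by blast
    let ?f = "(!) [x, x', y, y']"
    \<comment> \<open>Rows and columns are the same vertices here; the absence of loops keeps the
      four corners distinct.\<close>
    have "x \<noteq> y" "x \<noteq> y'" "x' \<noteq> y" "x' \<noteq> y'" using a by (auto dest: pair_no_loops)
    then have "inj_on ?f (pverts K22)" using ne by (auto simp: inj_on_def K22_def)
    moreover have "map_prod ?f ?f ` parcs K22 \<subseteq> parcs D" using a by (auto simp: K22_def)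
    moreover have "?f ` pverts K22 \<subseteq> pverts D"
      using a by (auto simp: K22_def dest: arc_fst_in_verts arc_snd_in_verts)
    ultimately show "contains_copy D K22" unfolding contains_copy_iff[OF wf] by blast
  qed
  then show ?thesis by (simp add: H_free_def)
qed

section \<open>Bipartite graphs as relations between their sides\<close>

definition bip_graph :: "'a set \<Rightarrow> 'a set \<Rightarrow> ('a \<times> 'a) set \<Rightarrow> 'a pair_pre_digraph" where
  "bip_graph X Y E = \<lparr>pverts = X \<union> Y, parcs = E \<union> E\<inverse>\<rparr>"

lemma balanced_bipartite_bip_graph:
  assumes "X \<inter> Y = {}" "E \<subseteq> X \<times> Y" "finite X" "finite Y" "card X = n" "card Y = n"
  shows "balanced_bipartite n (bip_graph X Y E)"
proof -
  have "finite E" using assms by (meson finite_SigmaI finite_subset)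
  then have "pair_graph (bip_graph X Y E)"
    using assms
    by unfold_locales (auto simp: bip_graph_def symmetric_def sym_def)
  then show ?thesis
    using assms unfolding balanced_bipartite_def
    by (intro conjI exI[of _ X] exI[of _ Y]) (auto simp: bip_graph_def)
qed

text \<open>Take for \<open>E\<close> the arcs from \<open>X\<close> to \<open>Y\<close>; symmetry
  returns the others.\<close>

lemma balanced_bipartiteE:
  assumes "balanced_bipartite n G"
  obtains X Y E where "G = bip_graph X Y E" "X \<inter> Y = {}" "E \<subseteq> X \<times> Y" "finite X" "finite Y"
    "card X = n" "card Y = n"
proof -
  obtain X Y where XY: "pverts G = X \<union> Y" "X \<inter> Y = {}" "card X = n" "card Y = n"
    "parcs G \<subseteq> X \<times> Y \<union> Y \<times> X" and "pair_graph G"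
    using assms unfolding balanced_bipartite_def by blast
  interpret pair_graph G by fact
  have "sym (parcs G)" using pair_sym_arcs by (simp add: symmetric_def)
  then have "parcs G = (parcs G \<inter> X \<times> Y) \<union> (parcs G \<inter> X \<times> Y)\<inverse>"
    using XY(5) by (auto dest: symD)
  then have "G = bip_graph X Y (parcs G \<inter> X \<times> Y)"
    using XY(1) by (simp add: bip_graph_def)
  moreover have "finite X" "finite Y" using pair_finite_verts XY(1) by auto
  ultimately show thesis using XY that by blast
qed

lemma card_undirected_edges_bip_graph:
  assumes "X \<inter> Y = {}" "E \<subseteq> X \<times> Y"
  shows "card (undirected_edges (bip_graph X Y E)) = card E"
proof -
  have "undirected_edges (bip_graph X Y E) = (\<lambda>(u, v). {u, v}) ` E"
    by (force simp: undirected_edges_def bip_graph_def)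
  \<comment> \<open>Disjoint sides: an unordered edge reveals which end lies in
    \<open>X\<close>.\<close>
  moreover have "inj_on (\<lambda>(u, v). {u, v}) E"
    using assms by (fastforce simp: inj_on_def doubleton_eq_iff)
  ultimately show ?thesis by (simp add: card_image)
qed

lemma H_free_C4_bip_graph_iff:
  assumes disj: "X \<inter> Y = {}" and E: "E \<subseteq> X \<times> Y"
  shows "H_free C4 (bip_graph X Y E) \<longleftrightarrow> rect_free E"
proof -
  have wf: "pair_wf_digraph (bip_graph X Y E)" "pair_wf_digraph C4"
    using E by (unfold_locales; auto simp: C4_def bip_graph_def)+
  have "contains_copy (bip_graph X Y E) C4 \<longleftrightarrow> \<not> rect_free E"
  proof
    assume "contains_copy (bip_graph X Y E) C4"
    then obtain f where "inj_on f (pverts C4)"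
      and arcs: "map_prod f f ` parcs C4 \<subseteq> E \<union> E\<inverse>"
      unfolding contains_copy_iff[OF wf] by (auto simp: bip_graph_def)
    then have ne: "f 0 \<noteq> f 2" "f 1 \<noteq> f 3" by (simp_all add: C4_def inj_on_def)
    have a: "(f 0, f 1) \<in> E \<union> E\<inverse>" "(f 1, f 2) \<in> E \<union> E\<inverse>" "(f 2, f 3) \<in> E \<union> E\<inverse>"
        "(f 3, f 0) \<in> E \<union> E\<inverse>"
      using arcs by (simp_all add: C4_def)
    show "\<not> rect_free E"
    \<comment> \<open>The cycle alternates between the sides, so the even vertices are the two rows
      in the first case and the two columns in the second.\<close>
    proof (cases "f 0 \<in> X")
      case True
      then have "(f 0, f 1) \<in> E" "(f 0, f 3) \<in> E" "(f 2, f 1) \<in> E" "(f 2, f 3) \<in> E"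
        using a E disj by blast+
      then show ?thesis using ne unfolding rect_free_def by blast
    next
      case False
      then have "(f 1, f 0) \<in> E" "(f 3, f 0) \<in> E" "(f 1, f 2) \<in> E" "(f 3, f 2) \<in> E"
        using a E disj by blast+
      then show ?thesis using ne unfolding rect_free_def by blast
    qed
  next
    assume "\<not> rect_free E"
    then obtain x x' y y' where a: "(x, y) \<in> E" "(x, y') \<in> E" "(x', y) \<in> E"
      "(x', y') \<in> E" and ne: "x \<noteq> x'" "y \<noteq> y'"
      unfolding rect_free_def by blast
    let ?f = "(!) [x, y, x', y']"
    have XY: "x \<in> X" "x' \<in> X" "y \<in> Y" "y' \<in> Y" using a E by auto
    then have "x \<noteq> y" "x \<noteq> y'" "x' \<noteq> y" "x' \<noteq> y'" using disj by auto
    then have "inj_on ?f (pverts C4)" using ne by (auto simp: inj_on_def C4_def)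
    moreover have "map_prod ?f ?f ` parcs C4 \<subseteq> parcs (bip_graph X Y E)"
      using a by (auto simp: C4_def bip_graph_def)
    moreover have "?f ` pverts C4 \<subseteq> pverts (bip_graph X Y E)"
      using XY by (auto simp: C4_def bip_graph_def)
    ultimately show "contains_copy (bip_graph X Y E) C4"
      unfolding contains_copy_iff[OF wf] by blast
  qed
  then show ?thesis by (simp add: H_free_def)
qed

lemma bip_graph_in_bipartite_free_iff:
  assumes "X \<inter> Y = {}" "E \<subseteq> X \<times> Y" "finite X" "finite Y" "card X = n" "card Y = n"
  shows "bip_graph X Y E \<in> bipartite_free n C4 \<longleftrightarrow> rect_free E"
  using balanced_bipartite_bip_graph[OF assms] H_free_C4_bip_graph_iff[OF assms(1,2)]
  by (simp add: bipartite_free_def)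

lemma digraphs_free_K22_iff:
  "D \<in> digraphs_free n K22 \<longleftrightarrow> pair_digraph D \<and> card (pverts D) = n \<and> rect_free (parcs D)"
  by (auto simp: digraphs_free_def H_free_K22_iff)

section \<open>Comparing the extremal numbers\<close>

lemma pair_digraph_parcs_subset: "pair_digraph D \<Longrightarrow> parcs D \<subseteq> pverts D \<times> pverts D"
  by (force dest: pair_wf_digraph.arc_fst_in_verts pair_wf_digraph.arc_snd_in_verts
      simp: pair_digraph_def pair_fin_digraph_def)

lemma pair_digraph_finite_pverts: "pair_digraph D \<Longrightarrow> finite (pverts D)"
  by (simp add: pair_digraph_def pair_fin_digraph.pair_finite_verts)

text \<open>\<open>f\<close> and \<open>g\<close> make two disjoint copies of each vertex. The
  general form serves both \<open>Brp\<close> and a copy inside \<open>nat\<close>, where the maxima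
  are taken.\<close>

lemma bip_graph_of_digraph:
  fixes D :: "'a pair_pre_digraph" and f g :: "'a \<Rightarrow> 'b"
  assumes D: "pair_digraph D" "card (pverts D) = n"
    and inj: "inj f" "inj g" and disj: "range f \<inter> range g = {}"
  defines "B \<equiv> bip_graph (f ` pverts D) (g ` pverts D) (map_prod f g ` parcs D)"
  shows "B \<in> bipartite_free n C4 \<longleftrightarrow> D \<in> digraphs_free n K22"
    and "card (undirected_edges B) = card (parcs D)"
proof -
  note injs = inj_on_subset[OF inj(1) subset_UNIV] inj_on_subset[OF inj(2) subset_UNIV]
  note sub = pair_digraph_parcs_subset[OF D(1)]
  have XY: "f ` pverts D \<inter> g ` pverts D = {}"
    and E: "map_prod f g ` parcs D \<subseteq> f ` pverts D \<times> g ` pverts D"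
    using disj sub by auto
  have "B \<in> bipartite_free n C4 \<longleftrightarrow> rect_free (map_prod f g ` parcs D)"
    unfolding B_def using XY E D pair_digraph_finite_pverts[OF D(1)] injs
    by (intro bip_graph_in_bipartite_free_iff) (auto simp: card_image)
  also have "\<dots> \<longleftrightarrow> rect_free (parcs D)"
    using injs sub by (rule rect_free_map_prod)
  finally show "B \<in> bipartite_free n C4 \<longleftrightarrow> D \<in> digraphs_free n K22"
    using D by (simp add: digraphs_free_K22_iff)
  show "card (undirected_edges B) = card (parcs D)"
    unfolding B_def card_undirected_edges_bip_graph[OF XY E]
    using injs sub by (rule card_map_prod_image)
qed

text \<open>Distinct rows \<open>i\<close>, \<open>j\<close> sharing both columns would give i + 1 =
  j + 2 and i + 2 = j + 1 modulo \<open>n\<close>, hence 2 = 0, impossible for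
  \<open>n \<ge> 3\<close>. The same bound excludes loops.\<close>

lemma cyclic_digraph:
  assumes n: "n \<ge> 3"
  obtains D :: "nat pair_pre_digraph" where "D \<in> digraphs_free n K22" "card (parcs D) = 2 * n"
proof -
  define A where "A = (SIGMA i:{..<n}. {Suc i mod n, Suc (Suc i) mod n})"
  have step: "Suc i mod n = (if Suc i = n then 0 else Suc i)"
    "Suc (Suc i) mod n = (if Suc (Suc i) < n then Suc (Suc i) else Suc (Suc i) - n)" if "i < n" for i
    using that n by (auto simp: mod_if)
  \<comment> \<open>Wraparound is written additively as \<open>j + n\<close>, which leaves
    rectangle-freeness to linear arithmetic.\<close>
  have mem: "(i, j) \<in> A \<longleftrightarrow> i < n \<and> j < n \<and>
      (j = Suc i \<or> j = Suc (Suc i) \<or> j + n = Suc i \<or> j + n = Suc (Suc i))" for i j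
  proof (cases "i < n")
    case True
    then have "(i, j) \<in> A \<longleftrightarrow> j = (if Suc i = n then 0 else Suc i) \<or>
        j = (if Suc (Suc i) < n then Suc (Suc i) else Suc (Suc i) - n)"
      by (simp add: A_def step)
    then show ?thesis using True n by (auto split: if_splits)
  qed (simp add: A_def)
  have "Suc i mod n \<noteq> Suc (Suc i) mod n" if "i < n" for i
    unfolding step[OF that] using n that by presburger
  then have "card {Suc i mod n, Suc (Suc i) mod n} = 2" if "i < n" for i
    using that by simp
  then have card: "card A = 2 * n" unfolding A_def by (subst card_SigmaI) auto
  have "rect_free A"
    unfolding rect_free_def mem using n by (intro allI impI, elim conjE disjE; linarith)
  moreover have "finite A" by (simp add: A_def)
  then have "pair_digraph \<lparr>pverts = {..<n}, parcs = A\<rparr>"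
    by unfold_locales (use n in \<open>auto simp: mem\<close>)
  ultimately have "\<lparr>pverts = {..<n}, parcs = A\<rparr> \<in> digraphs_free n K22"
    by (simp add: digraphs_free_K22_iff)
  then show thesis using that card by simp
qed

lemma digraph_of_bip_graph:
  fixes G :: "nat pair_pre_digraph"
  assumes n: "n \<ge> 3" and G: "G \<in> bipartite_free n C4"
  obtains D :: "nat pair_pre_digraph"
    where "D \<in> digraphs_free n K22" "card (undirected_edges G) \<le> card (parcs D)"
proof -
  obtain X Y E where GE: "G = bip_graph X Y E" and XY: "X \<inter> Y = {}" "E \<subseteq> X \<times> Y"
    and fin: "finite X" "finite Y" and card: "card X = n" "card Y = n"
    using G by (auto simp: bipartite_free_def elim: balanced_bipartiteE)
  have R: "rect_free E"
    using G bip_graph_in_bipartite_free_iff[OF XY fin card] by (simp add: GE)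
  have edges: "card (undirected_edges G) = card E"
    using XY by (simp add: GE card_undirected_edges_bip_graph)
  show thesis
  proof (cases "(\<exists>x\<in>X. {x} \<times> Y \<subseteq> E) \<or> (\<exists>y\<in>Y. X \<times> {y} \<subseteq> E)")
    case True
    \<comment> \<open>Fewer than \<open>2 * n\<close> edges, so the cyclic digraph has more
      arcs.\<close>
    then have "card E < card X + card Y"
      using card_full_row[OF R XY(2) fin] card_full_column[OF R XY(2) fin] by blast
    then show thesis using cyclic_digraph[OF n] that edges card
      by (metis less_imp_le mult_2)
  next
    case False
    then obtain f where f: "bij_betw f X Y" and avoid: "\<And>x. x \<in> X \<Longrightarrow> (x, f x) \<notin> E"
      using rect_free_avoiding_bijection[OF R fin] card by metis
    \<comment> \<open>Column \<open>y\<close> is identified with row \<open>g y\<close>. A loop at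
      \<open>x\<close> would come from the entry \<open>(x, f x)\<close>, which \<open>f\<close>
      avoids.\<close>
    define g where "g = inv_into X f"
    have g: "inj_on g Y" "g ` Y = X" and fg: "\<And>y. y \<in> Y \<Longrightarrow> f (g y) = y"
      using bij_betw_inv_into[OF f] f
      by (auto simp: g_def bij_betw_def f_inv_into_f)
    define A where "A = map_prod id g ` E"
    have "rect_free A"
      using R rect_free_map_prod[OF inj_on_id g(1) XY(2)] by (simp add: A_def)
    moreover have "card A = card E"
      unfolding A_def using inj_on_id g(1) XY(2) by (rule card_map_prod_image)
    moreover have "finite A" unfolding A_def using XY(2) fin by (meson finite_SigmaI finite_imageI finite_subset)
    moreover have "fst e \<in> X \<and> snd e \<in> X \<and> fst e \<noteq> snd e" if "e \<in> A" for e
      using that XY(2) g(2) fg avoid by (fastforce simp: A_def)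
    then have "pair_digraph \<lparr>pverts = X, parcs = A\<rparr>"
      using \<open>finite A\<close> fin by unfold_locales auto
    ultimately have "\<lparr>pverts = X, parcs = A\<rparr> \<in> digraphs_free n K22" "card A = card E"
      using card by (simp_all add: digraphs_free_K22_iff)
    then show thesis using that edges by simp
  qed
qed

section \<open>Equality of the maxima\<close>

lemma finite_card_parcs_digraphs_free: "finite ((\<lambda>D. card (parcs D)) ` digraphs_free n K22)"
proof -
  have "card (parcs D) \<le> n * n" if "D \<in> digraphs_free n K22" for D :: "'a pair_pre_digraph"
    using that card_mono[OF _ pair_digraph_parcs_subset, of D] pair_digraph_finite_pverts[of D]
    by (auto simp: digraphs_free_K22_iff card_cartesian_product)
  then show ?thesis by (auto intro: finite_subset[of _ "{..n * n}"])
qed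

lemma finite_card_edges_bipartite_free:
  "finite ((\<lambda>G. card (undirected_edges G)) ` bipartite_free n C4)"
proof -
  have "card (undirected_edges G) \<le> n * n" if "G \<in> bipartite_free n C4" for G :: "'a pair_pre_digraph"
  proof -
    obtain X Y E where GE: "G = bip_graph X Y E" "X \<inter> Y = {}" "E \<subseteq> X \<times> Y"
      "finite X" "finite Y" "card X = n" "card Y = n"
      using \<open>G \<in> bipartite_free n C4\<close> by (auto simp: bipartite_free_def elim: balanced_bipartiteE)
    then have "card E \<le> card (X \<times> Y)" by (intro card_mono) auto
    then show ?thesis using GE by (simp add: card_undirected_edges_bip_graph card_cartesian_product)
  qed
  then show ?thesis by (auto intro: finite_subset[of _ "{..n * n}"])
qed

lemma ex_di_eq_ex_bip:
  assumes n: "n \<ge> 3"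
  shows "ex_di n K22 = ex_bip n C4"
proof -
  let ?P = "(\<lambda>D :: nat pair_pre_digraph. card (parcs D)) ` digraphs_free n K22"
  let ?Q = "(\<lambda>G :: nat pair_pre_digraph. card (undirected_edges G)) ` bipartite_free n C4"
  \<comment> \<open>The families over \<open>nat\<close> are infinite, but the sizes are bounded by
    \<open>n * n\<close>, so both \<open>Max\<close> are attained once the sets are
    nonempty.\<close>
  have fin: "finite ?P" "finite ?Q"
    by (rule finite_card_parcs_digraphs_free finite_card_edges_bipartite_free)+
  have PQ: "?P \<subseteq> ?Q"
  proof
    fix m assume "m \<in> ?P"
    then obtain D :: "nat pair_pre_digraph" where D: "D \<in> digraphs_free n K22" "m = card (parcs D)"
      by blast
    \<comment> \<open>Even and odd numbers provide the two disjoint copies within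
      \<open>nat\<close>.\<close>
    let ?B = "bip_graph ((\<lambda>v. 2 * v) ` pverts D) ((\<lambda>v. Suc (2 * v)) ` pverts D)
      (map_prod (\<lambda>v. 2 * v) (\<lambda>v. Suc (2 * v)) ` parcs D)"
    have "?B \<in> bipartite_free n C4 \<longleftrightarrow> D \<in> digraphs_free n K22"
      and "card (undirected_edges ?B) = card (parcs D)"
      using D by (intro bip_graph_of_digraph; auto simp: digraphs_free_K22_iff inj_on_def; presburger)+
    then show "m \<in> ?Q" using D by (metis imageI)
  qed
  have ne: "?P \<noteq> {}" using cyclic_digraph[OF n] by blast
  show ?thesis
    unfolding ex_di_def ex_bip_def
  proof (rule antisym)
    show "Max ?P \<le> Max ?Q" using PQ ne fin(2) by (rule Max_mono)
    have "Max ?Q \<in> ?Q" using fin(2) PQ ne by (intro Max_in) auto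
    then obtain D :: "nat pair_pre_digraph"
      where "D \<in> digraphs_free n K22" "Max ?Q \<le> card (parcs D)"
      using digraph_of_bip_graph[OF n] by (metis (no_types, lifting) imageE)
    then show "Max ?Q \<le> Max ?P" using fin(1) by (meson Max_ge imageI le_trans)
  qed
qed

lemma Brp_eq_bip_graph:
  "Brp D = bip_graph (Inl ` pverts D) (Inr ` pverts D) (map_prod Inl Inr ` parcs D)"
  by (force simp: Brp_def bip_graph_def Plus_def)

theorem theorem1p11:
  fixes n :: nat
  assumes "n \<ge> 3"
  shows "ex_di n K22 = ex_bip n C4 \<and>
    (EX_di n K22 :: 'a pair_pre_digraph set) =
      {D. pair_digraph D \<and> card (pverts D) = n \<and> Brp D \<in> EX_bip n C4}"
proof -
  \<comment> \<open>Freeness and size transfer for each \<open>D\<close> over any vertex type, so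
    equal extremal numbers yield equal families.\<close>
  have "Brp D \<in> bipartite_free n C4 \<longleftrightarrow> D \<in> digraphs_free n K22"
    "card (undirected_edges (Brp D)) = card (parcs D)"
    if "pair_digraph D" "card (pverts D) = n" for D :: "'a pair_pre_digraph"
    unfolding Brp_eq_bip_graph using that by (intro bip_graph_of_digraph; auto)+
  then show ?thesis
    using ex_di_eq_ex_bip[OF assms]
    by (auto simp: EX_di_def EX_bip_def digraphs_free_def)
qed

end
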